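(* Let $\Gamma \Rightarrow \Delta$ be a sequent of $\mathcal{L}_{\mathsf{RTC}}$. If there is an $\mathsf{RTC}^{\omega}_{G}$ proof of $\Gamma \Rightarrow \Delta$, then $\Gamma \Rightarrow \Delta$ is valid with respect to the standard semantics.
   Context: Fix a first-order signature $\sigma$ with equality. Formulas of $\mathcal{L}_{\mathsf{RTC}}$: $\varphi ::= s=t \mid P(t_1,\dots,t_n) \mid \neg\varphi \mid \varphi\wedge\varphi \mid \varphi\vee\varphi \mid \varphi\to\varphi \mid \forall x.\varphi \mid \exists x.\varphi \mid (RTC_{x,y}\,\varphi)(s,t)$, where $s,t,t_i$ are terms and $x,y$ are distinct variables bound in $\varphi$ (but not in $s,t$). Formulas are identified up to renaming of bound variables; $\varphi[t_1/x_1,\dots,t_n/x_n]$ is capture-avoiding simultaneous substitution. Standard semantics: for a first-order structure $M=\langle D,I\rangle$ and valuation $v$, satisfaction is as usual, and $M,v\models (RTC_{x,y}\varphi)(s,t)$ iff $v(s)=v(t)$, or there are $a_0,\dots,a_n\in D$ ($n>0$) with $a_0=v(s)$, $a_n=v(t)$ and $M,v[x:=a_i,y:=a_{i+1}]\models\varphi$ for all $0\le i<n$. A sequent $\Gamma\Rightarrow\Delta$ is a pair of finite sets of formulas; it is valid if every $M,v$ satisfying all of $\Gamma$ satisfies some formula of $\Delta$. The calculus $\mathcal{LK}_=$ has: axiom $\varphi\Rightarrow\varphi$; left/right weakening; the usual classical left and right rules for $\neg,\wedge,\vee,\to$; $(\forall L)$: from $\Gamma,\varphi[t/x]\Rightarrow\Delta$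 infer $\Gamma,\forall x.\varphi\Rightarrow\Delta$; $(\exists R)$: from $\Gamma\Rightarrow\varphi[t/x],\Delta$ infer $\Gamma\Rightarrow\exists x.\varphi,\Delta$; $(\forall R)$: from $\Gamma\Rightarrow\varphi,\Delta$ infer $\Gamma\Rightarrow\forall x.\varphi,\Delta$, and $(\exists L)$: from $\Gamma,\varphi\Rightarrow\Delta$ infer $\Gamma,\exists x.\varphi\Rightarrow\Delta$, both with $x\notin fv(\Gamma,\Delta)$; $(=L_1)$: from $\Gamma\Rightarrow\varphi[s/x],\Delta$ infer $\Gamma,s=t\Rightarrow\varphi[t/x],\Delta$; $(=L_2)$: from $\Gamma\Rightarrow\varphi[t/x],\Delta$ infer $\Gamma,s=t\Rightarrow\varphi[s/x],\Delta$; $(=R)$: $\Rightarrow t=t$; (Cut): from $\Gamma\Rightarrow\varphi,\Delta$ and $\Sigma,\varphi\Rightarrow\Pi$ infer $\Gamma,\Sigma\Rightarrow\Delta,\Pi$; (Subst): from $\Gamma\Rightarrow\Delta$ infer $\Gamma\theta\Rightarrow\Delta\theta$ for any substitution $\theta$. $\mathsf{RTC}^{\omega}_{G}$ is $\mathcal{LK}_=$ plus: (Refl) $\Gamma\Rightarrow\Delta,(RTC_{x,y}\varphi)(s,s)$; (Trans) from $\Gamma\Rightarrow\Delta,(RTC_{x,y}\varphi)(s,r)$ and $\Gamma\Rightarrow\Delta,\varphi[r/x,t/y]$ infer $\Gamma\Rightarrow\Delta,(RTC_{x,y}\varphi)(s,t)$ (any term $r$); (Case) from $\Gamma,s=t\Rightarrow\Delta$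 and $\Gamma,(RTC_{x,y}\varphi)(s,z),\varphi[z/x,t/y]\Rightarrow\Delta$ infer $\Gamma,(RTC_{x,y}\varphi)(s,t)\Rightarrow\Delta$, where $z$ is a variable not free in $\Gamma,\Delta,(RTC_{x,y}\varphi)(s,t)$; the formula $(RTC_{x,y}\varphi)(s,z)$ is the immediate ancestor of the principal formula $(RTC_{x,y}\varphi)(s,t)$. A pre-proof is a possibly infinite (non-well-founded) derivation tree built from these rules with no open leaves; a path is a sequence of sequents starting at the root, each next one a premise of the previous. For $RTC$-formulas $\tau,\tau'$ in the left-hand sides of the conclusion $S$ and a premise $S'$ of a rule instance, $(\tau,\tau')$ is a trace pair for $(S,S')$ if: the rule is (Subst) with substitution $\theta$ and $\tau=\tau'\theta$; or the rule is (Case) and either $\tau$ is the principal formula and $\tau'$ its immediate ancestor (a progressing pair) or $\tau=\tau'$; or the rule is any other rule and $\tau=\tau'$. A trace $\tau_1,\tau_2,\dots$ follows a path $S_1,S_2,\dots$ if for some $k\ge 0$ each $(\tau_i,\tau_{i+1})$ is a trace pair for $(S_{i+k},S_{i+k+1})$; it is infinitely progressing if infinitely many of these pairs are progressing. An $\mathsf{RTC}^{\omega}_{G}$ proof is a pre-proof in which every infinite path is followed by some infinitely progressing trace. *)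

theory Defs
  imports "HOL-Library.FSet" "HOL-Library.Infinite_Set"
begin

section \<open>Syntax\<close>

text \<open>A symbol outside the domain of the arity map does not belong to the signature; thus the
  signature may have no function symbols (or no predicate symbols) at all.\<close>

record ('f, 'p) signature =
  fun_arity :: "'f \<Rightarrow> nat option"
  pred_arity :: "'p \<Rightarrow> nat option"

datatype 'f tm = Var nat | Fun 'f "'f tm list"

text \<open>
  Formulas up to renaming of bound variables are represented by de Bruijn terms.  A formula
  standing by itself has the variables \<open>x\<^sub>0, x\<^sub>1, \<dots>\<close> free, \<open>Var n\<close> being \<open>x\<^sub>n\<close>.
  \<open>FAll\<close> and \<open>FEx\<close> bind index \<open>0\<close>; in \<open>FRTC \<phi> s t\<close> the indices \<open>0\<close> (source) and \<open>1\<close> (target)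
  are bound in \<open>\<phi>\<close>, and nothing is bound in \<open>s\<close> and \<open>t\<close>.  The binders with a named variable
  are \<open>all_fm\<close>, \<open>ex_fm\<close> and \<open>rtc_fm\<close> below, and the proof rules only use these.
\<close>

datatype ('f, 'p) fm =
    FEq "'f tm" "'f tm"
  | FPred 'p "'f tm list"
  | FNeg "('f, 'p) fm"
  | FAnd "('f, 'p) fm" "('f, 'p) fm"
  | FOr "('f, 'p) fm" "('f, 'p) fm"
  | FImp "('f, 'p) fm" "('f, 'p) fm"
  | FAll "('f, 'p) fm"
  | FEx "('f, 'p) fm"
  | FRTC "('f, 'p) fm" "'f tm" "'f tm"

fun wf_tm :: "('f, 'p) signature \<Rightarrow> 'f tm \<Rightarrow> bool" where
  "wf_tm \<sigma> (Var n) \<longleftrightarrow> True"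
| "wf_tm \<sigma> (Fun f ts) \<longleftrightarrow> fun_arity \<sigma> f = Some (length ts) \<and> (\<forall>t\<in>set ts. wf_tm \<sigma> t)"

primrec wf_fm :: "('f, 'p) signature \<Rightarrow> ('f, 'p) fm \<Rightarrow> bool" where
  "wf_fm \<sigma> (FEq s t) \<longleftrightarrow> wf_tm \<sigma> s \<and> wf_tm \<sigma> t"
| "wf_fm \<sigma> (FPred p ts) \<longleftrightarrow> pred_arity \<sigma> p = Some (length ts) \<and> (\<forall>t\<in>set ts. wf_tm \<sigma> t)"
| "wf_fm \<sigma> (FNeg \<phi>) \<longleftrightarrow> wf_fm \<sigma> \<phi>"
| "wf_fm \<sigma> (FAnd \<phi> \<psi>) \<longleftrightarrow> wf_fm \<sigma> \<phi> \<and> wf_fm \<sigma> \<psi>"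
| "wf_fm \<sigma> (FOr \<phi> \<psi>) \<longleftrightarrow> wf_fm \<sigma> \<phi> \<and> wf_fm \<sigma> \<psi>"
| "wf_fm \<sigma> (FImp \<phi> \<psi>) \<longleftrightarrow> wf_fm \<sigma> \<phi> \<and> wf_fm \<sigma> \<psi>"
| "wf_fm \<sigma> (FAll \<phi>) \<longleftrightarrow> wf_fm \<sigma> \<phi>"
| "wf_fm \<sigma> (FEx \<phi>) \<longleftrightarrow> wf_fm \<sigma> \<phi>"
| "wf_fm \<sigma> (FRTC \<phi> s t) \<longleftrightarrow> wf_fm \<sigma> \<phi> \<and> wf_tm \<sigma> s \<and> wf_tm \<sigma> t"

fun fv_tm :: "'f tm \<Rightarrow> nat set" where
  "fv_tm (Var n) = {n}"
| "fv_tm (Fun f ts) = (\<Union>t\<in>set ts. fv_tm t)"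

primrec fv_fm :: "('f, 'p) fm \<Rightarrow> nat set" where
  "fv_fm (FEq s t) = fv_tm s \<union> fv_tm t"
| "fv_fm (FPred p ts) = (\<Union>t\<in>set ts. fv_tm t)"
| "fv_fm (FNeg \<phi>) = fv_fm \<phi>"
| "fv_fm (FAnd \<phi> \<psi>) = fv_fm \<phi> \<union> fv_fm \<psi>"
| "fv_fm (FOr \<phi> \<psi>) = fv_fm \<phi> \<union> fv_fm \<psi>"
| "fv_fm (FImp \<phi> \<psi>) = fv_fm \<phi> \<union> fv_fm \<psi>"
| "fv_fm (FAll \<phi>) = {n. Suc n \<in> fv_fm \<phi>}"
| "fv_fm (FEx \<phi>) = {n. Suc n \<in> fv_fm \<phi>}"
| "fv_fm (FRTC \<phi> s t) = {n. Suc (Suc n) \<in> fv_fm \<phi>} \<union> fv_tm s \<union> fv_tm t"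

text \<open>Capture-avoiding simultaneous substitution.\<close>

type_synonym 'f subst = "nat \<Rightarrow> 'f tm"

fun subst_tm :: "'f tm \<Rightarrow> 'f subst \<Rightarrow> 'f tm" where
  "subst_tm (Var n) \<theta> = \<theta> n"
| "subst_tm (Fun f ts) \<theta> = Fun f (map (\<lambda>t. subst_tm t \<theta>) ts)"

text \<open>\<open>\<theta>\<close> pushed under one binder.\<close>

definition up :: "'f subst \<Rightarrow> 'f subst" where
  "up \<theta> = case_nat (Var 0) (\<lambda>n. subst_tm (\<theta> n) (\<lambda>m. Var (Suc m)))"

primrec subst_fm :: "('f, 'p) fm \<Rightarrow> 'f subst \<Rightarrow> ('f, 'p) fm" where
  "subst_fm (FEq s t) \<theta> = FEq (subst_tm s \<theta>) (subst_tm t \<theta>)"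
| "subst_fm (FPred p ts) \<theta> = FPred p (map (\<lambda>t. subst_tm t \<theta>) ts)"
| "subst_fm (FNeg \<phi>) \<theta> = FNeg (subst_fm \<phi> \<theta>)"
| "subst_fm (FAnd \<phi> \<psi>) \<theta> = FAnd (subst_fm \<phi> \<theta>) (subst_fm \<psi> \<theta>)"
| "subst_fm (FOr \<phi> \<psi>) \<theta> = FOr (subst_fm \<phi> \<theta>) (subst_fm \<psi> \<theta>)"
| "subst_fm (FImp \<phi> \<psi>) \<theta> = FImp (subst_fm \<phi> \<theta>) (subst_fm \<psi> \<theta>)"
| "subst_fm (FAll \<phi>) \<theta> = FAll (subst_fm \<phi> (up \<theta>))"
| "subst_fm (FEx \<phi>) \<theta> = FEx (subst_fm \<phi> (up \<theta>))"
| "subst_fm (FRTC \<phi> s t) \<theta> =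
     FRTC (subst_fm \<phi> (up (up \<theta>))) (subst_tm s \<theta>) (subst_tm t \<theta>)"

text \<open>\<open>sub1 \<phi> t x\<close> is \<open>\<phi>[t/x]\<close> and \<open>sub2 \<phi> s x t y\<close> is \<open>\<phi>[s/x, t/y]\<close> (for \<open>x \<noteq> y\<close>).\<close>

definition sub1 :: "('f, 'p) fm \<Rightarrow> 'f tm \<Rightarrow> nat \<Rightarrow> ('f, 'p) fm" where
  "sub1 \<phi> t x = subst_fm \<phi> (Var(x := t))"

definition sub2 :: "('f, 'p) fm \<Rightarrow> 'f tm \<Rightarrow> nat \<Rightarrow> 'f tm \<Rightarrow> nat \<Rightarrow> ('f, 'p) fm" where
  "sub2 \<phi> s x t y = subst_fm \<phi> (Var(x := s, y := t))"

text \<open>Binding of named variables: the variable \<open>x\<close> is turned into the bound index, the other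
  variables are shifted.  For \<open>x \<noteq> y\<close>, \<open>rtc_fm x y \<phi> s t\<close> is \<open>(RTC\<^bsub>x,y\<^esub> \<phi>)(s,t)\<close>.\<close>

definition all_fm :: "nat \<Rightarrow> ('f, 'p) fm \<Rightarrow> ('f, 'p) fm" where
  "all_fm x \<phi> = FAll (subst_fm \<phi> (\<lambda>n. if n = x then Var 0 else Var (Suc n)))"

definition ex_fm :: "nat \<Rightarrow> ('f, 'p) fm \<Rightarrow> ('f, 'p) fm" where
  "ex_fm x \<phi> = FEx (subst_fm \<phi> (\<lambda>n. if n = x then Var 0 else Var (Suc n)))"

definition rtc_fm :: "nat \<Rightarrow> nat \<Rightarrow> ('f, 'p) fm \<Rightarrow> 'f tm \<Rightarrow> 'f tm \<Rightarrow> ('f, 'p) fm" where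
  "rtc_fm x y \<phi> s t =
     FRTC (subst_fm \<phi> (\<lambda>n. if n = x then Var 0 else if n = y then Var 1 else Var (Suc (Suc n)))) s t"

definition is_rtc :: "('f, 'p) fm \<Rightarrow> bool" where
  "is_rtc \<tau> \<longleftrightarrow> (\<exists>x y \<phi> s t. x \<noteq> y \<and> \<tau> = rtc_fm x y \<phi> s t)"

text \<open>The named binders behave as expected with respect to free variables, and every de Bruijn
  formula with a binder at the top arises from a named binder, with any fresh names.\<close>

lemma fv_tm_subst: "fv_tm (subst_tm t \<theta>) = (\<Union>n\<in>fv_tm t. fv_tm (\<theta> n))"
  by (induction t) auto

lemma fv_tm_up:
  "m \<in> fv_tm (up \<theta> n) \<longleftrightarrow> (case n of 0 \<Rightarrow> m = 0 | Suc k \<Rightarrow> \<exists>j. m = Suc j \<and> j \<in> fv_tm (\<theta> k))"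
  by (auto simp: up_def fv_tm_subst split: nat.split)

lemma Suc_fv_tm_up:
  "{m. Suc m \<in> (\<Union>n\<in>A. fv_tm (up \<theta> n))} = (\<Union>n\<in>{n. Suc n \<in> A}. fv_tm (\<theta> n))"
proof (rule set_eqI)
  fix m
  have "(\<exists>n\<in>A. Suc m \<in> fv_tm (up \<theta> n)) \<longleftrightarrow> (\<exists>n. Suc n \<in> A \<and> m \<in> fv_tm (\<theta> n))"
    (is "?L \<longleftrightarrow> ?R")
  proof
    assume ?L
    then obtain n where n: "n \<in> A" "Suc m \<in> fv_tm (up \<theta> n)" by blast
    then show ?R by (cases n) (auto simp: fv_tm_up)
  next
    assume ?R
    then obtain n where "Suc n \<in> A" "m \<in> fv_tm (\<theta> n)" by blast
    then show ?L by (intro bexI[of _ "Suc n"]) (auto simp: fv_tm_up)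
  qed
  then show "m \<in> {m. Suc m \<in> (\<Union>n\<in>A. fv_tm (up \<theta> n))} \<longleftrightarrow>
      m \<in> (\<Union>n\<in>{n. Suc n \<in> A}. fv_tm (\<theta> n))"
    by simp
qed

lemma fv_fm_subst: "fv_fm (subst_fm \<phi> \<theta>) = (\<Union>n\<in>fv_fm \<phi>. fv_tm (\<theta> n))"
proof (induction \<phi> arbitrary: \<theta>)
  case (FRTC \<phi> s t)
  have "{n. Suc (Suc n) \<in> (\<Union>m\<in>fv_fm \<phi>. fv_tm (up (up \<theta>) m))} =
      {n. Suc n \<in> {m. Suc m \<in> (\<Union>m\<in>fv_fm \<phi>. fv_tm (up (up \<theta>) m))}}"
    by simp
  also have "\<dots> = (\<Union>n\<in>{n. Suc (Suc n) \<in> fv_fm \<phi>}. fv_tm (\<theta> n))"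
    unfolding Suc_fv_tm_up by simp
  finally show ?case
    by (simp only: fv_fm.simps subst_fm.simps FRTC fv_tm_subst UN_Un)
next
  case (FAll \<phi>)
  show ?case by (simp only: fv_fm.simps subst_fm.simps FAll Suc_fv_tm_up)
next
  case (FEx \<phi>)
  show ?case by (simp only: fv_fm.simps subst_fm.simps FEx Suc_fv_tm_up)
qed (auto simp: fv_tm_subst)

lemma fv_all_fm: "fv_fm (all_fm x \<phi>) = fv_fm \<phi> - {x}"
  by (auto simp: all_fm_def fv_fm_subst split: if_splits)

lemma fv_ex_fm: "fv_fm (ex_fm x \<phi>) = fv_fm \<phi> - {x}"
  by (auto simp: ex_fm_def fv_fm_subst split: if_splits)

lemma fv_rtc_fm:
  "x \<noteq> y \<Longrightarrow> fv_fm (rtc_fm x y \<phi> s t) = (fv_fm \<phi> - {x, y}) \<union> fv_tm s \<union> fv_tm t"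
  by (auto simp: rtc_fm_def fv_fm_subst split: if_splits)

lemma subst_tm_subst: "subst_tm (subst_tm t \<theta>) \<eta> = subst_tm t (\<lambda>n. subst_tm (\<theta> n) \<eta>)"
  by (induction t) auto

lemma subst_up: "(\<lambda>n. subst_tm (up \<theta> n) (up \<eta>)) = up (\<lambda>n. subst_tm (\<theta> n) \<eta>)"
  by (rule ext) (simp add: up_def subst_tm_subst split: nat.split)

lemma subst_fm_subst: "subst_fm (subst_fm \<phi> \<theta>) \<eta> = subst_fm \<phi> (\<lambda>n. subst_tm (\<theta> n) \<eta>)"
  by (induction \<phi> arbitrary: \<theta> \<eta>) (simp_all add: subst_tm_subst subst_up)

lemma up_Var: "up Var = Var"
  by (rule ext) (simp add: up_def split: nat.split)

lemma subst_tm_Var: "subst_tm t Var = t"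
  by (induction t) (auto simp: map_idI)

lemma subst_fm_Var: "subst_fm \<phi> Var = \<phi>"
  by (induction \<phi>) (auto simp: up_Var subst_tm_Var map_idI)

lemma subst_tm_cong: "(\<And>n. n \<in> fv_tm t \<Longrightarrow> \<theta> n = \<eta> n) \<Longrightarrow> subst_tm t \<theta> = subst_tm t \<eta>"
  by (induction t) auto

lemma subst_fm_cong: "(\<And>n. n \<in> fv_fm \<phi> \<Longrightarrow> \<theta> n = \<eta> n) \<Longrightarrow> subst_fm \<phi> \<theta> = subst_fm \<phi> \<eta>"
proof (induction \<phi> arbitrary: \<theta> \<eta>)
  case (FAll \<phi>)
  have "up \<theta> n = up \<eta> n" if "n \<in> fv_fm \<phi>" for n
    using FAll.prems that by (auto simp: up_def split: nat.split)
  from FAll.IH[OF this] show ?case by simp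
next
  case (FEx \<phi>)
  have "up \<theta> n = up \<eta> n" if "n \<in> fv_fm \<phi>" for n
    using FEx.prems that by (auto simp: up_def split: nat.split)
  from FEx.IH[OF this] show ?case by simp
next
  case (FRTC \<phi> s t)
  have "up (up \<theta>) n = up (up \<eta>) n" if "n \<in> fv_fm \<phi>" for n
    using FRTC.prems that by (auto simp: up_def split: nat.split)
  moreover have "subst_tm s \<theta> = subst_tm s \<eta>" "subst_tm t \<theta> = subst_tm t \<eta>"
    by (rule subst_tm_cong, simp add: FRTC.prems)+
  ultimately show ?case using FRTC.IH[of "up (up \<theta>)" "up (up \<eta>)"] by simp
next
  case (FEq s t)
  have "subst_tm s \<theta> = subst_tm s \<eta>" "subst_tm t \<theta> = subst_tm t \<eta>"
    by (rule subst_tm_cong, simp add: FEq.prems)+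
  then show ?case by simp
next
  case (FPred p ts)
  have "subst_tm t \<theta> = subst_tm t \<eta>" if "t \<in> set ts" for t
    by (rule subst_tm_cong) (use that FPred.prems in auto)
  then show ?case by simp
next
  case (FNeg \<phi>)
  have "subst_fm \<phi> \<theta> = subst_fm \<phi> \<eta>" by (rule FNeg.IH) (simp add: FNeg.prems)
  then show ?case by simp
next
  case (FAnd \<phi> \<psi>)
  have "subst_fm \<phi> \<theta> = subst_fm \<phi> \<eta>" by (rule FAnd.IH) (simp add: FAnd.prems)
  moreover have "subst_fm \<psi> \<theta> = subst_fm \<psi> \<eta>" by (rule FAnd.IH) (simp add: FAnd.prems)
  ultimately show ?case by simp
next
  case (FOr \<phi> \<psi>)
  have "subst_fm \<phi> \<theta> = subst_fm \<phi> \<eta>" by (rule FOr.IH) (simp add: FOr.prems)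
  moreover have "subst_fm \<psi> \<theta> = subst_fm \<psi> \<eta>" by (rule FOr.IH) (simp add: FOr.prems)
  ultimately show ?case by simp
next
  case (FImp \<phi> \<psi>)
  have "subst_fm \<phi> \<theta> = subst_fm \<phi> \<eta>" by (rule FImp.IH) (simp add: FImp.prems)
  moreover have "subst_fm \<psi> \<theta> = subst_fm \<psi> \<eta>" by (rule FImp.IH) (simp add: FImp.prems)
  ultimately show ?case by simp
qed

lemma FAll_eq_all_fm:
  assumes "x \<notin> fv_fm (FAll \<phi>)"
  shows "FAll \<phi> = all_fm x (subst_fm \<phi> (case_nat (Var x) Var))"
proof -
  have "subst_fm \<phi> Var = subst_fm \<phi> (\<lambda>n. subst_tm (case_nat (Var x) Var n)
      (\<lambda>n. if n = x then Var 0 else Var (Suc n)))"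
    by (rule subst_fm_cong) (use assms in \<open>auto split: nat.split\<close>)
  from this[symmetric] show ?thesis
    by (simp only: all_fm_def subst_fm_subst subst_fm_Var)
qed

lemma FEx_eq_ex_fm:
  assumes "x \<notin> fv_fm (FEx \<phi>)"
  shows "FEx \<phi> = ex_fm x (subst_fm \<phi> (case_nat (Var x) Var))"
proof -
  have "x \<notin> fv_fm (FAll \<phi>)" using assms by simp
  from FAll_eq_all_fm[OF this] show ?thesis
    unfolding all_fm_def ex_fm_def fm.inject .
qed

lemma FRTC_eq_rtc_fm:
  assumes "x \<noteq> y" "x \<notin> fv_fm (FRTC \<phi> s t)" "y \<notin> fv_fm (FRTC \<phi> s t)"
  shows "FRTC \<phi> s t = rtc_fm x y (subst_fm \<phi> (case_nat (Var x) (case_nat (Var y) Var))) s t"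
proof -
  have "subst_fm \<phi> Var = subst_fm \<phi> (\<lambda>n. subst_tm (case_nat (Var x) (case_nat (Var y) Var) n)
      (\<lambda>n. if n = x then Var 0 else if n = y then Var 1 else Var (Suc (Suc n))))"
    by (rule subst_fm_cong) (use assms in \<open>auto split: nat.split\<close>)
  from this[symmetric] show ?thesis
    by (simp only: rtc_fm_def subst_fm_subst subst_fm_Var)
qed

section \<open>Standard semantics\<close>

record ('d, 'f, 'p) struct =
  univ :: "'d set"
  fun_int :: "'f \<Rightarrow> 'd list \<Rightarrow> 'd"
  pred_int :: "'p \<Rightarrow> 'd list \<Rightarrow> bool"

definition is_struct :: "('f, 'p) signature \<Rightarrow> ('d, 'f, 'p) struct \<Rightarrow> bool" where
  "is_struct \<sigma> M \<longleftrightarrow> univ M \<noteq> {} \<and>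
     (\<forall>f ds. fun_arity \<sigma> f = Some (length ds) \<and> set ds \<subseteq> univ M \<longrightarrow> fun_int M f ds \<in> univ M)"

definition is_valuation :: "('d, 'f, 'p) struct \<Rightarrow> (nat \<Rightarrow> 'd) \<Rightarrow> bool" where
  "is_valuation M v \<longleftrightarrow> range v \<subseteq> univ M"

fun val :: "('d, 'f, 'p) struct \<Rightarrow> (nat \<Rightarrow> 'd) \<Rightarrow> 'f tm \<Rightarrow> 'd" where
  "val M v (Var n) = v n"
| "val M v (Fun f ts) = fun_int M f (map (val M v) ts)"

primrec sat :: "('d, 'f, 'p) struct \<Rightarrow> (nat \<Rightarrow> 'd) \<Rightarrow> ('f, 'p) fm \<Rightarrow> bool" where
  "sat M v (FEq s t) \<longleftrightarrow> val M v s = val M v t"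
| "sat M v (FPred p ts) \<longleftrightarrow> pred_int M p (map (val M v) ts)"
| "sat M v (FNeg \<phi>) \<longleftrightarrow> \<not> sat M v \<phi>"
| "sat M v (FAnd \<phi> \<psi>) \<longleftrightarrow> sat M v \<phi> \<and> sat M v \<psi>"
| "sat M v (FOr \<phi> \<psi>) \<longleftrightarrow> sat M v \<phi> \<or> sat M v \<psi>"
| "sat M v (FImp \<phi> \<psi>) \<longleftrightarrow> (sat M v \<phi> \<longrightarrow> sat M v \<psi>)"
| "sat M v (FAll \<phi>) \<longleftrightarrow> (\<forall>d\<in>univ M. sat M (case_nat d v) \<phi>)"
| "sat M v (FEx \<phi>) \<longleftrightarrow> (\<exists>d\<in>univ M. sat M (case_nat d v) \<phi>)"
| "sat M v (FRTC \<phi> s t) \<longleftrightarrow> val M v s = val M v t \<or>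
     (\<exists>n a. n > 0 \<and> (\<forall>i\<le>n. a i \<in> univ M) \<and> a 0 = val M v s \<and> a n = val M v t \<and>
        (\<forall>i<n. sat M (case_nat (a i) (case_nat (a (Suc i)) v)) \<phi>))"

text \<open>The clauses for the named binders read as usual.\<close>

lemma val_subst: "val M v (subst_tm t \<theta>) = val M (\<lambda>n. val M v (\<theta> n)) t"
  by (induction t) (simp_all cong: map_cong)

lemma val_up: "(\<lambda>n. val M (case_nat d v) (up \<theta> n)) = case_nat d (\<lambda>n. val M v (\<theta> n))"
  by (rule ext) (simp add: up_def val_subst split: nat.split)

lemma sat_subst: "sat M v (subst_fm \<phi> \<theta>) \<longleftrightarrow> sat M (\<lambda>n. val M v (\<theta> n)) \<phi>"
  by (induction \<phi> arbitrary: v \<theta>) (simp_all add: val_subst val_up comp_def)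

lemma sat_all_fm: "sat M v (all_fm x \<phi>) \<longleftrightarrow> (\<forall>d\<in>univ M. sat M (v(x := d)) \<phi>)"
proof -
  have "(\<lambda>n. val M (case_nat d v) (if n = x then Var 0 else Var (Suc n))) = v(x := d)" for d
    by auto
  then show ?thesis by (simp add: all_fm_def sat_subst)
qed

lemma sat_ex_fm: "sat M v (ex_fm x \<phi>) \<longleftrightarrow> (\<exists>d\<in>univ M. sat M (v(x := d)) \<phi>)"
proof -
  have "(\<lambda>n. val M (case_nat d v) (if n = x then Var 0 else Var (Suc n))) = v(x := d)" for d
    by auto
  then show ?thesis by (simp add: ex_fm_def sat_subst)
qed

lemma sat_rtc_fm:
  assumes "x \<noteq> y"
  shows "sat M v (rtc_fm x y \<phi> s t) \<longleftrightarrow> val M v s = val M v t \<or>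
     (\<exists>n a. n > 0 \<and> (\<forall>i\<le>n. a i \<in> univ M) \<and> a 0 = val M v s \<and> a n = val M v t \<and>
        (\<forall>i<n. sat M (v(x := a i, y := a (Suc i))) \<phi>))"
proof -
  have "(\<lambda>n. val M (case_nat d (case_nat e v))
          (if n = x then Var 0 else if n = y then Var 1 else Var (Suc (Suc n)))) =
        v(x := d, y := e)" for d e
    using assms by auto
  then show ?thesis by (simp add: rtc_fm_def sat_subst)
qed

section \<open>Sequents\<close>

type_synonym ('f, 'p) sequent = "('f, 'p) fm fset \<times> ('f, 'p) fm fset"

definition wf_sequent :: "('f, 'p) signature \<Rightarrow> ('f, 'p) sequent \<Rightarrow> bool" where
  "wf_sequent \<sigma> S \<longleftrightarrow> (\<forall>\<phi>. \<phi> |\<in>| fst S \<or> \<phi> |\<in>| snd S \<longrightarrow> wf_fm \<sigma> \<phi>)"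

definition fvs :: "('f, 'p) fm fset \<Rightarrow> nat set" where
  "fvs \<Gamma> = (\<Union>\<phi>\<in>fset \<Gamma>. fv_fm \<phi>)"

text \<open>The type argument is the type from which the universes of the structures are drawn.\<close>

definition valid :: "'d itself \<Rightarrow> ('f, 'p) signature \<Rightarrow> ('f, 'p) sequent \<Rightarrow> bool" where
  "valid _ \<sigma> S \<longleftrightarrow>
     (\<forall>(M :: ('d, 'f, 'p) struct) v. is_struct \<sigma> M \<and> is_valuation M v \<longrightarrow>
        (\<forall>\<phi>. \<phi> |\<in>| fst S \<longrightarrow> sat M v \<phi>) \<longrightarrow> (\<exists>\<psi>. \<psi> |\<in>| snd S \<and> sat M v \<psi>))"

section \<open>Rules\<close>

text \<open>The data of a rule instance on which trace pairs depend: the substitution for (Subst); the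
  principal formula and its immediate ancestor for (Case); nothing for the other rules.\<close>

datatype ('f, 'p) label =
    Subst "'f subst"
  | Case "('f, 'p) fm" "('f, 'p) fm"
  | Other

text \<open>\<open>rule_inst \<sigma> l S Ss\<close>: from the premises \<open>Ss\<close> infer \<open>S\<close>.  As sequents consist of sets, the
  comma is (non-disjoint) union and contraction is built in.  That the formulas are built from the
  symbols of \<open>\<sigma>\<close> is imposed on whole sequents in \<open>preproof\<close>.\<close>

inductive rule_inst :: "('f, 'p) signature \<Rightarrow> ('f, 'p) label \<Rightarrow> ('f, 'p) sequent \<Rightarrow>
    ('f, 'p) sequent list \<Rightarrow> bool" for \<sigma> where
  Ax: "rule_inst \<sigma> Other ({|\<phi>|}, {|\<phi>|}) []"
| WeakL: "rule_inst \<sigma> Other (finsert \<phi> \<Gamma>, \<Delta>) [(\<Gamma>, \<Delta>)]"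
| WeakR: "rule_inst \<sigma> Other (\<Gamma>, finsert \<phi> \<Delta>) [(\<Gamma>, \<Delta>)]"
| NegL: "rule_inst \<sigma> Other (finsert (FNeg \<phi>) \<Gamma>, \<Delta>) [(\<Gamma>, finsert \<phi> \<Delta>)]"
| NegR: "rule_inst \<sigma> Other (\<Gamma>, finsert (FNeg \<phi>) \<Delta>) [(finsert \<phi> \<Gamma>, \<Delta>)]"
| AndL: "rule_inst \<sigma> Other (finsert (FAnd \<phi> \<psi>) \<Gamma>, \<Delta>) [(finsert \<phi> (finsert \<psi> \<Gamma>), \<Delta>)]"
| AndR: "rule_inst \<sigma> Other (\<Gamma>, finsert (FAnd \<phi> \<psi>) \<Delta>)
    [(\<Gamma>, finsert \<phi> \<Delta>), (\<Gamma>, finsert \<psi> \<Delta>)]"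
| OrL: "rule_inst \<sigma> Other (finsert (FOr \<phi> \<psi>) \<Gamma>, \<Delta>)
    [(finsert \<phi> \<Gamma>, \<Delta>), (finsert \<psi> \<Gamma>, \<Delta>)]"
| OrR: "rule_inst \<sigma> Other (\<Gamma>, finsert (FOr \<phi> \<psi>) \<Delta>) [(\<Gamma>, finsert \<phi> (finsert \<psi> \<Delta>))]"
| ImpL: "rule_inst \<sigma> Other (finsert (FImp \<phi> \<psi>) \<Gamma>, \<Delta>)
    [(\<Gamma>, finsert \<phi> \<Delta>), (finsert \<psi> \<Gamma>, \<Delta>)]"
| ImpR: "rule_inst \<sigma> Other (\<Gamma>, finsert (FImp \<phi> \<psi>) \<Delta>) [(finsert \<phi> \<Gamma>, finsert \<psi> \<Delta>)]"
| AllL: "wf_tm \<sigma> t \<Longrightarrow>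
    rule_inst \<sigma> Other (finsert (all_fm x \<phi>) \<Gamma>, \<Delta>) [(finsert (sub1 \<phi> t x) \<Gamma>, \<Delta>)]"
| AllR: "x \<notin> fvs \<Gamma> \<union> fvs \<Delta> \<Longrightarrow>
    rule_inst \<sigma> Other (\<Gamma>, finsert (all_fm x \<phi>) \<Delta>) [(\<Gamma>, finsert \<phi> \<Delta>)]"
| ExL: "x \<notin> fvs \<Gamma> \<union> fvs \<Delta> \<Longrightarrow>
    rule_inst \<sigma> Other (finsert (ex_fm x \<phi>) \<Gamma>, \<Delta>) [(finsert \<phi> \<Gamma>, \<Delta>)]"
| ExR: "wf_tm \<sigma> t \<Longrightarrow>
    rule_inst \<sigma> Other (\<Gamma>, finsert (ex_fm x \<phi>) \<Delta>) [(\<Gamma>, finsert (sub1 \<phi> t x) \<Delta>)]"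
| EqL1: "rule_inst \<sigma> Other (finsert (FEq s t) \<Gamma>, finsert (sub1 \<phi> t x) \<Delta>)
    [(\<Gamma>, finsert (sub1 \<phi> s x) \<Delta>)]"
| EqL2: "rule_inst \<sigma> Other (finsert (FEq s t) \<Gamma>, finsert (sub1 \<phi> s x) \<Delta>)
    [(\<Gamma>, finsert (sub1 \<phi> t x) \<Delta>)]"
| EqR: "rule_inst \<sigma> Other ({||}, {|FEq t t|}) []"
| Cut: "rule_inst \<sigma> Other (\<Gamma> |\<union>| \<Sigma>, \<Delta> |\<union>| \<Pi>) [(\<Gamma>, finsert \<phi> \<Delta>), (finsert \<phi> \<Sigma>, \<Pi>)]"
| Subst: "(\<And>n. wf_tm \<sigma> (\<theta> n)) \<Longrightarrow>
    rule_inst \<sigma> (Subst \<theta>) ((\<lambda>\<phi>. subst_fm \<phi> \<theta>) |`| \<Gamma>, (\<lambda>\<phi>. subst_fm \<phi> \<theta>) |`| \<Delta>) [(\<Gamma>, \<Delta>)]"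
| Refl: "x \<noteq> y \<Longrightarrow> rule_inst \<sigma> Other (\<Gamma>, finsert (rtc_fm x y \<phi> s s) \<Delta>) []"
| Trans: "x \<noteq> y \<Longrightarrow>
    rule_inst \<sigma> Other (\<Gamma>, finsert (rtc_fm x y \<phi> s t) \<Delta>)
      [(\<Gamma>, finsert (rtc_fm x y \<phi> s r) \<Delta>), (\<Gamma>, finsert (sub2 \<phi> r x t y) \<Delta>)]"
| Case: "x \<noteq> y \<Longrightarrow> z \<notin> fvs \<Gamma> \<union> fvs \<Delta> \<union> fv_fm (rtc_fm x y \<phi> s t) \<Longrightarrow>
    rule_inst \<sigma> (Case (rtc_fm x y \<phi> s t) (rtc_fm x y \<phi> s (Var z)))
      (finsert (rtc_fm x y \<phi> s t) \<Gamma>, \<Delta>)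
      [(finsert (FEq s t) \<Gamma>, \<Delta>),
       (finsert (rtc_fm x y \<phi> s (Var z)) (finsert (sub2 \<phi> (Var z) x t y) \<Gamma>), \<Delta>)]"

section \<open>Pre-proofs and proofs\<close>

codatatype ('f, 'p) deriv =
  Node (concl: "('f, 'p) sequent") (lab: "('f, 'p) label") (subs: "('f, 'p) deriv list")

coinductive preproof :: "('f, 'p) signature \<Rightarrow> ('f, 'p) deriv \<Rightarrow> bool" for \<sigma> where
  "wf_sequent \<sigma> (concl D) \<Longrightarrow> rule_inst \<sigma> (lab D) (concl D) (map concl (subs D)) \<Longrightarrow>
   (\<forall>E\<in>set (subs D). preproof \<sigma> E) \<Longrightarrow> preproof \<sigma> D"

text \<open>Paths are given by the subderivations at their nodes, since the sequents alone do not
  determine the rule instances applied.\<close>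

definition infinite_path :: "('f, 'p) deriv \<Rightarrow> (nat \<Rightarrow> ('f, 'p) deriv) \<Rightarrow> bool" where
  "infinite_path D B \<longleftrightarrow> B 0 = D \<and> (\<forall>i. B (Suc i) \<in> set (subs (B i)))"

fun progressing :: "('f, 'p) label \<Rightarrow> ('f, 'p) fm \<Rightarrow> ('f, 'p) fm \<Rightarrow> bool" where
  "progressing (Case \<pi> \<alpha>) \<tau> \<tau>' \<longleftrightarrow> \<tau> = \<pi> \<and> \<tau>' = \<alpha>"
| "progressing _ \<tau> \<tau>' \<longleftrightarrow> False"

fun linked :: "('f, 'p) label \<Rightarrow> ('f, 'p) fm \<Rightarrow> ('f, 'p) fm \<Rightarrow> bool" where
  "linked (Subst \<theta>) \<tau> \<tau>' \<longleftrightarrow> \<tau> = subst_fm \<tau>' \<theta>"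
| "linked (Case \<pi> \<alpha>) \<tau> \<tau>' \<longleftrightarrow> progressing (Case \<pi> \<alpha>) \<tau> \<tau>' \<or> \<tau> = \<tau>'"
| "linked Other \<tau> \<tau>' \<longleftrightarrow> \<tau> = \<tau>'"

definition trace_pair :: "('f, 'p) label \<Rightarrow> ('f, 'p) sequent \<Rightarrow> ('f, 'p) sequent \<Rightarrow>
    ('f, 'p) fm \<Rightarrow> ('f, 'p) fm \<Rightarrow> bool" where
  "trace_pair l S S' \<tau> \<tau>' \<longleftrightarrow>
     is_rtc \<tau> \<and> is_rtc \<tau>' \<and> \<tau> |\<in>| fst S \<and> \<tau>' |\<in>| fst S' \<and> linked l \<tau> \<tau>'"

definition trace_follows :: "nat \<Rightarrow> (nat \<Rightarrow> ('f, 'p) fm) \<Rightarrow> (nat \<Rightarrow> ('f, 'p) deriv) \<Rightarrow> bool" where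
  "trace_follows k \<tau> B \<longleftrightarrow>
     (\<forall>i. trace_pair (lab (B (i + k))) (concl (B (i + k))) (concl (B (i + k + 1))) (\<tau> i) (\<tau> (i + 1)))"

definition is_proof :: "('f, 'p) signature \<Rightarrow> ('f, 'p) deriv \<Rightarrow> bool" where
  "is_proof \<sigma> D \<longleftrightarrow> preproof \<sigma> D \<and>
     (\<forall>B. infinite_path D B \<longrightarrow>
        (\<exists>k \<tau>. trace_follows k \<tau> B \<and>
           (\<exists>\<^sub>\<infinity>i. progressing (lab (B (i + k))) (\<tau> i) (\<tau> (i + 1)))))"

end

theory Submission
  imports Defs
begin

text \<open>
  Infinite descent.  A countermodel of the conclusion of a rule instance yields a countermodel, over
  the same structure, of one of the premises.  Measure a satisfied \<open>RTC\<close> formula by the length of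
  its shortest chain of witnesses: along a trace pair this length does not increase, and (Case), with
  the fresh variable interpreted by the last but one element of a shortest chain, decreases it
  strictly.  A countermodel of the root thus gives an infinite path along which no trace can
  progress infinitely often.
\<close>

section \<open>Dependence of values and truth on the valuation\<close>

lemma val_cong: "(\<And>n. n \<in> fv_tm t \<Longrightarrow> v n = w n) \<Longrightarrow> val M v t = val M w t"
proof (induction t)
  case (Fun f ts)
  then have "map (val M v) ts = map (val M w) ts" by auto
  then show ?case by (simp only: val.simps)
qed simp

text \<open>The terms \<open>s\<close> and \<open>t\<close> do not enter the body, so the principal
  formula of (Case) and its immediate ancestor share it and differ only in the target.\<close>

definition rtc_body :: "nat \<Rightarrow> nat \<Rightarrow> ('f, 'p) fm \<Rightarrow> ('f, 'p) fm" where
  "rtc_body x y \<phi> =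
     subst_fm \<phi> (\<lambda>n. if n = x then Var 0 else if n = y then Var 1 else Var (Suc (Suc n)))"

lemma rtc_fm_eq: "rtc_fm x y \<phi> s t = FRTC (rtc_body x y \<phi>) s t"
  by (simp add: rtc_fm_def rtc_body_def)

lemma sat_rtc_body:
  assumes "x \<noteq> y"
  shows "sat M (case_nat d (case_nat e v)) (rtc_body x y \<phi>) \<longleftrightarrow> sat M (v(x := d, y := e)) \<phi>"
proof -
  have "(\<lambda>n. val M (case_nat d (case_nat e v))
          (if n = x then Var 0 else if n = y then Var 1 else Var (Suc (Suc n)))) =
        v(x := d, y := e)"
    using assms by auto
  then show ?thesis by (simp only: rtc_body_def sat_subst)
qed

text \<open>Quantifiers and chains range over \<open>univ M\<close>, so terms instantiated by a rule
  must denote inside it; \<open>is_struct\<close> ensures this for terms that respect the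
  arities.\<close>

lemma val_in_univ:
  "is_struct \<sigma> M \<Longrightarrow> is_valuation M v \<Longrightarrow> wf_tm \<sigma> t \<Longrightarrow> val M v t \<in> univ M"
proof (induction t)
  case (Var n)
  then show ?case by (auto simp: is_valuation_def)
next
  case (Fun f ts)
  then have "set (map (val M v) ts) \<subseteq> univ M" by auto
  with Fun.prems show ?case
    unfolding is_struct_def by (metis length_map val.simps(2) wf_tm.simps(2))
qed

lemma is_valuation_upd: "is_valuation M v \<Longrightarrow> d \<in> univ M \<Longrightarrow> is_valuation M (v(x := d))"
  by (auto simp: is_valuation_def)

lemma sat_cong: "(\<And>n. n \<in> fv_fm \<phi> \<Longrightarrow> v n = w n) \<Longrightarrow> sat M v \<phi> \<longleftrightarrow> sat M w \<phi>"
proof (induction \<phi> arbitrary: v w)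
  case (FEq s t)
  then show ?case using val_cong[of s v w M] val_cong[of t v w M] by simp
next
  case (FPred p ts)
  then have "map (val M v) ts = map (val M w) ts" by (auto intro: val_cong)
  then show ?case by (simp only: sat.simps)
next
  case (FNeg \<phi>)
  then show ?case by (metis fv_fm.simps(3) sat.simps(3))
next
  case (FAnd \<phi> \<psi>)
  then show ?case by (metis UnCI fv_fm.simps(4) sat.simps(4))
next
  case (FOr \<phi> \<psi>)
  then show ?case by (metis UnCI fv_fm.simps(5) sat.simps(5))
next
  case (FImp \<phi> \<psi>)
  then show ?case by (metis UnCI fv_fm.simps(6) sat.simps(6))
next
  case (FAll \<phi>)
  have "sat M (case_nat d v) \<phi> \<longleftrightarrow> sat M (case_nat d w) \<phi>" for d
    by (rule FAll.IH) (use FAll.prems in \<open>auto split: nat.split\<close>)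
  then show ?case by simp
next
  case (FEx \<phi>)
  have "sat M (case_nat d v) \<phi> \<longleftrightarrow> sat M (case_nat d w) \<phi>" for d
    by (rule FEx.IH) (use FEx.prems in \<open>auto split: nat.split\<close>)
  then show ?case by simp
next
  case (FRTC \<phi> s t)
  have "sat M (case_nat d (case_nat e v)) \<phi> \<longleftrightarrow> sat M (case_nat d (case_nat e w)) \<phi>" for d e
    by (rule FRTC.IH) (use FRTC.prems in \<open>auto split: nat.split\<close>)
  moreover have "val M v s = val M w s" "val M v t = val M w t"
    by (rule val_cong, simp add: FRTC.prems)+
  ultimately show ?case by simp
qed

lemma sat_upd: "x \<notin> fv_fm \<phi> \<Longrightarrow> sat M (v(x := d)) \<phi> \<longleftrightarrow> sat M v \<phi>"
  by (rule sat_cong) auto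

lemma sat_sub1: "sat M v (sub1 \<phi> t x) \<longleftrightarrow> sat M (v(x := val M v t)) \<phi>"
proof -
  have "(\<lambda>n. val M v ((Var(x := t)) n)) = v(x := val M v t)" by auto
  then show ?thesis by (simp only: sub1_def sat_subst)
qed

lemma sat_sub2:
  "sat M v (sub2 \<phi> s x t y) \<longleftrightarrow> sat M (v(x := val M v s, y := val M v t)) \<phi>"
proof -
  have "(\<lambda>n. val M v ((Var(x := s, y := t)) n)) = v(x := val M v s, y := val M v t)" by auto
  then show ?thesis by (simp only: sub2_def sat_subst)
qed

section \<open>Chains of witnesses and the length of RTC formulas\<close>

text \<open>Membership in the universe is not required for \<open>n = 0\<close>, in accordance with the first disjunct
  of the clause for \<open>FRTC\<close> in \<open>sat\<close>.\<close>

definition rtc_chain :: "('d, 'f, 'p) struct \<Rightarrow> (nat \<Rightarrow> 'd) \<Rightarrow> ('f, 'p) fm \<Rightarrow> 'd \<Rightarrow> 'd \<Rightarrow> nat \<Rightarrow> bool"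
  where
  "rtc_chain M v \<phi> d e n \<longleftrightarrow>
     (\<exists>a. (0 < n \<longrightarrow> (\<forall>i\<le>n. a i \<in> univ M)) \<and> a 0 = d \<and> a n = e \<and>
        (\<forall>i<n. sat M (case_nat (a i) (case_nat (a (Suc i)) v)) \<phi>))"

lemma rtc_chain_0: "rtc_chain M v \<phi> d e 0 \<longleftrightarrow> d = e"
  by (auto simp: rtc_chain_def)

text \<open>Chains are split at the last step because (Trans) and (Case) lengthen and shorten them
  at the target.\<close>

lemma rtc_chain_SucE:
  assumes "rtc_chain M v \<phi> d e (Suc n)"
  obtains c where "c \<in> univ M" "rtc_chain M v \<phi> d c n" "sat M (case_nat c (case_nat e v)) \<phi>"
  using assms unfolding rtc_chain_def by (metis le_SucI less_Suc_eq order_refl zero_less_Suc)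

lemma rtc_chain_SucI:
  assumes "rtc_chain M v \<phi> d c n" "sat M (case_nat c (case_nat e v)) \<phi>" "d \<in> univ M" "e \<in> univ M"
  shows "rtc_chain M v \<phi> d e (Suc n)"
proof -
  from assms(1) obtain a where a: "0 < n \<Longrightarrow> \<forall>i\<le>n. a i \<in> univ M" "a 0 = d" "a n = c"
      "\<forall>i<n. sat M (case_nat (a i) (case_nat (a (Suc i)) v)) \<phi>"
    by (auto simp: rtc_chain_def)
  \<comment> \<open>A chain of length 0 does not record that its point lies in the universe; there
    the assumption on \<open>d\<close> supplies it.\<close>
  have "\<forall>i\<le>n. a i \<in> univ M" using a(1,2) assms(3) by (cases "n = 0") auto
  with a(2-) assms(2,4) show ?thesis
    unfolding rtc_chain_def by (intro exI[of _ "a(Suc n := e)"]) (auto simp: le_Suc_eq less_Suc_eq)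
qed

text \<open>The equality disjunct of \<open>sat\<close> becomes the chain of length 0, so one number
  measures both disjuncts.\<close>

lemma sat_FRTC: "sat M v (FRTC \<phi> s t) \<longleftrightarrow> (\<exists>n. rtc_chain M v \<phi> (val M v s) (val M v t) n)"
proof
  assume "sat M v (FRTC \<phi> s t)"
  then consider "val M v s = val M v t" |
    "\<exists>n a. n > 0 \<and> (\<forall>i\<le>n. a i \<in> univ M) \<and> a 0 = val M v s \<and> a n = val M v t \<and>
        (\<forall>i<n. sat M (case_nat (a i) (case_nat (a (Suc i)) v)) \<phi>)"
    unfolding sat.simps by blast
  then show "\<exists>n. rtc_chain M v \<phi> (val M v s) (val M v t) n"
  proof cases
    case 1
    then show ?thesis by (intro exI[of _ 0]) (simp only: rtc_chain_0)
  next
    case 2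
    then obtain n a where "n > 0" "\<forall>i\<le>n. a i \<in> univ M" "a 0 = val M v s" "a n = val M v t"
        "\<forall>i<n. sat M (case_nat (a i) (case_nat (a (Suc i)) v)) \<phi>"
      by blast
    then show ?thesis unfolding rtc_chain_def by (intro exI[of _ n] exI[of _ a]) simp
  qed
next
  assume "\<exists>n. rtc_chain M v \<phi> (val M v s) (val M v t) n"
  then obtain n where n: "rtc_chain M v \<phi> (val M v s) (val M v t) n" ..
  show "sat M v (FRTC \<phi> s t)"
  proof (cases "n = 0")
    case True
    with n show ?thesis by (simp add: rtc_chain_0)
  next
    case False
    moreover from n obtain a where "0 < n \<longrightarrow> (\<forall>i\<le>n. a i \<in> univ M)" "a 0 = val M v s"
        "a n = val M v t" "\<forall>i<n. sat M (case_nat (a i) (case_nat (a (Suc i)) v)) \<phi>"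
      unfolding rtc_chain_def by blast
    ultimately show ?thesis unfolding sat.simps by (intro disjI2 exI[of _ n] exI[of _ a]) simp
  qed
qed

text \<open>The \<open>LEAST\<close> is meaningful only for satisfied formulas. This suffices:
  traces run through left-hand sides, which a countermodel satisfies. The 0 is a default for
  formulas that no trace visits.\<close>

fun rtc_length :: "('d, 'f, 'p) struct \<Rightarrow> (nat \<Rightarrow> 'd) \<Rightarrow> ('f, 'p) fm \<Rightarrow> nat" where
  "rtc_length M v (FRTC \<phi> s t) = (LEAST n. rtc_chain M v \<phi> (val M v s) (val M v t) n)"
| "rtc_length M v _ = 0"

lemma is_rtcE:
  assumes "is_rtc \<tau>"
  obtains \<phi> s t where "\<tau> = FRTC \<phi> s t"
  using assms by (auto simp: is_rtc_def rtc_fm_def)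

text \<open>Lets a fresh variable be revalued without affecting the lengths of the formulas in which
  it is not free.\<close>

lemma rtc_length_cong:
  assumes "is_rtc \<tau>" "\<And>n. n \<in> fv_fm \<tau> \<Longrightarrow> v n = w n"
  shows "rtc_length M v \<tau> = rtc_length M w \<tau>"
proof -
  obtain \<phi> s t where \<tau>: "\<tau> = FRTC \<phi> s t" using assms(1) by (rule is_rtcE)
  have "sat M (case_nat d (case_nat e v)) \<phi> \<longleftrightarrow> sat M (case_nat d (case_nat e w)) \<phi>" for d e
    by (rule sat_cong) (use assms(2) \<tau> in \<open>auto split: nat.split\<close>)
  moreover have "val M v s = val M w s" "val M v t = val M w t"
    by (rule val_cong, simp add: assms(2) \<tau>)+
  ultimately show ?thesis unfolding \<tau> rtc_length.simps rtc_chain_def by simp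
qed

text \<open>Serves the trace pairs of (Subst): both sides measure the same sequences of
  elements.\<close>

lemma rtc_length_subst:
  assumes "is_rtc \<tau>"
  shows "rtc_length M v (subst_fm \<tau> \<theta>) = rtc_length M (\<lambda>n. val M v (\<theta> n)) \<tau>"
proof -
  obtain \<phi> s t where \<tau>: "\<tau> = FRTC \<phi> s t" using assms by (rule is_rtcE)
  show ?thesis
    unfolding \<tau> subst_fm.simps rtc_length.simps rtc_chain_def by (simp add: sat_subst val_subst val_up)
qed

text \<open>The semantic content of (Case): the second alternative provides the value of the fresh
  variable.\<close>

lemma rtc_length_decompose:
  assumes "sat M v (FRTC \<phi> s t)" "val M v s \<noteq> val M v t"
  obtains c n where "c \<in> univ M" "rtc_chain M v \<phi> (val M v s) c n"
    "sat M (case_nat c (case_nat (val M v t) v)) \<phi>" "n < rtc_length M v (FRTC \<phi> s t)"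
proof -
  let ?m = "rtc_length M v (FRTC \<phi> s t)"
  have m: "rtc_chain M v \<phi> (val M v s) (val M v t) ?m"
    using assms(1) unfolding sat_FRTC rtc_length.simps by (rule LeastI_ex)
  \<comment> \<open>Distinct ends exclude length 0, so the shortest chain has a last step to
    remove.\<close>
  with assms(2) obtain n where n: "?m = Suc n"
    by (cases ?m) (auto simp only: rtc_chain_0)
  show thesis
    using m unfolding n by (rule rtc_chain_SucE) (use n that in auto)
qed

section \<open>Countermodels passed from conclusion to premise\<close>

definition falsifies :: "('d, 'f, 'p) struct \<Rightarrow> (nat \<Rightarrow> 'd) \<Rightarrow> ('f, 'p) sequent \<Rightarrow> bool" where
  "falsifies M v S \<longleftrightarrow> is_valuation M v \<and>
     (\<forall>\<phi>. \<phi> |\<in>| fst S \<longrightarrow> sat M v \<phi>) \<and> (\<forall>\<psi>. \<psi> |\<in>| snd S \<longrightarrow> \<not> sat M v \<psi>)"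

lemma falsifies_iff:
  "falsifies M v (\<Gamma>, \<Delta>) \<longleftrightarrow>
     is_valuation M v \<and> (\<forall>\<phi>\<in>fset \<Gamma>. sat M v \<phi>) \<and> (\<forall>\<psi>\<in>fset \<Delta>. \<not> sat M v \<psi>)"
  by (auto simp: falsifies_def)

lemma not_valid_falsifies:
  "\<not> valid TYPE('d) \<sigma> S \<longleftrightarrow> (\<exists>(M :: ('d, 'f, 'p) struct) v. is_struct \<sigma> M \<and> falsifies M v S)"
  for S :: "('f, 'p) sequent"
  by (auto simp: valid_def falsifies_def)

text \<open>The bound is required of all trace pairs at once because the path is built before the
  trace following it is known.\<close>

definition descends ::
  "('d, 'f, 'p) struct \<Rightarrow> ('f, 'p) label \<Rightarrow> (nat \<Rightarrow> 'd) \<Rightarrow> ('f, 'p) sequent \<Rightarrow>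
    (nat \<Rightarrow> 'd) \<Rightarrow> ('f, 'p) sequent \<Rightarrow> bool" where
  "descends M l v S v' S' \<longleftrightarrow> falsifies M v' S' \<and>
     (\<forall>\<tau> \<tau>'. trace_pair l S S' \<tau> \<tau>' \<longrightarrow>
        rtc_length M v' \<tau>' \<le> rtc_length M v \<tau> \<and>
        (progressing l \<tau> \<tau>' \<longrightarrow> rtc_length M v' \<tau>' < rtc_length M v \<tau>))"

lemma descends_Other: "falsifies M v S' \<Longrightarrow> descends M Other v S v S'"
  by (auto simp: descends_def trace_pair_def)

text \<open>For the eigenvariable rules: a trace stays at one formula of the conclusion, whose
  length ignores the new value of \<open>x\<close>.\<close>

lemma descends_Other_upd:
  assumes "falsifies M (v(x := d)) S'"
    and "\<And>\<tau>. is_rtc \<tau> \<Longrightarrow> \<tau> |\<in>| fst S \<Longrightarrow> x \<notin> fv_fm \<tau>"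
  shows "descends M Other v S (v(x := d)) S'"
proof -
  have "rtc_length M (v(x := d)) \<tau> = rtc_length M v \<tau>" if "is_rtc \<tau>" "\<tau> |\<in>| fst S" for \<tau>
    using that assms(2) by (intro rtc_length_cong) auto
  with assms(1) show ?thesis by (auto simp: descends_def trace_pair_def)
qed

lemma falsifies_Subst:
  assumes "is_struct \<sigma> M" "\<And>n. wf_tm \<sigma> (\<theta> n)"
    and "falsifies M v ((\<lambda>\<phi>. subst_fm \<phi> \<theta>) |`| \<Gamma>, (\<lambda>\<phi>. subst_fm \<phi> \<theta>) |`| \<Delta>)"
  shows "falsifies M (\<lambda>n. val M v (\<theta> n)) (\<Gamma>, \<Delta>)"
proof -
  have "is_valuation M (\<lambda>n. val M v (\<theta> n))"
    using assms(3) val_in_univ[OF assms(1) _ assms(2)]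
    by (simp add: is_valuation_def falsifies_iff image_subset_iff)
  then show ?thesis using assms(3) by (auto simp: falsifies_iff sat_subst)
qed

text \<open>The value of \<open>t\<close> is appended to a chain ending at the value of
  \<open>r\<close>. That \<open>r\<close> denotes inside the universe follows from the chain; for
  \<open>s\<close> and \<open>t\<close> it follows from well-formedness.\<close>

lemma sat_rtc_Trans:
  assumes "is_struct \<sigma> M" "is_valuation M v" "x \<noteq> y" "wf_tm \<sigma> s" "wf_tm \<sigma> t"
    and "sat M v (rtc_fm x y \<phi> s r)" "sat M v (sub2 \<phi> r x t y)"
  shows "sat M v (rtc_fm x y \<phi> s t)"
proof -
  have "sat M (case_nat (val M v r) (case_nat (val M v t) v)) (rtc_body x y \<phi>)"
    using assms(3,7) by (simp add: sat_rtc_body sat_sub2)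
  moreover obtain n where "rtc_chain M v (rtc_body x y \<phi>) (val M v s) (val M v r) n"
    using assms(6) unfolding rtc_fm_eq sat_FRTC by (rule exE)
  ultimately have "rtc_chain M v (rtc_body x y \<phi>) (val M v s) (val M v t) (Suc n)"
    using val_in_univ[OF assms(1,2)] assms(4,5) by (intro rtc_chain_SucI)
  then show ?thesis unfolding rtc_fm_eq sat_FRTC ..
qed

text \<open>Freshness of \<open>z\<close> also guarantees that the immediate ancestor, which contains \<open>z\<close>, occurs
  neither in the conclusion nor in the first premise; so it is only reached by the progressing
  pair.\<close>

lemma descends_Case:
  fixes x y z s t \<phi> \<Gamma> \<Delta>
  defines "\<pi> \<equiv> rtc_fm x y \<phi> s t" and "\<alpha> \<equiv> rtc_fm x y \<phi> s (Var z)"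
  defines "S \<equiv> (finsert \<pi> \<Gamma>, \<Delta>)"
    and "S1 \<equiv> (finsert (FEq s t) \<Gamma>, \<Delta>)"
    and "S2 \<equiv> (finsert \<alpha> (finsert (sub2 \<phi> (Var z) x t y) \<Gamma>), \<Delta>)"
  assumes xy: "x \<noteq> y" and z: "z \<notin> fvs \<Gamma> \<union> fvs \<Delta> \<union> fv_fm \<pi>"
    and S: "falsifies M v S"
  shows "\<exists>S'\<in>{S1, S2}. \<exists>v'. descends M (Case \<pi> \<alpha>) v S v' S'"
proof (cases "val M v s = val M v t")
  case True
  with S have "falsifies M v S1" by (auto simp: S_def S1_def falsifies_iff)
  moreover have "z \<in> fv_fm \<alpha>" using xy by (simp add: \<alpha>_def fv_rtc_fm)
  then have "\<not> trace_pair (Case \<pi> \<alpha>) S S1 \<tau> \<alpha>" for \<tau>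
    using z by (auto simp: trace_pair_def S1_def fvs_def \<alpha>_def rtc_fm_def)
  ultimately have "descends M (Case \<pi> \<alpha>) v S v S1"
    by (auto simp: descends_def) (auto simp: trace_pair_def)
  then show ?thesis by blast
next
  case False
  let ?\<phi> = "rtc_body x y \<phi>"
  have \<pi>: "\<pi> = FRTC ?\<phi> s t" and \<alpha>: "\<alpha> = FRTC ?\<phi> s (Var z)"
    by (simp_all add: \<pi>_def \<alpha>_def rtc_fm_eq)
  have "sat M v (FRTC ?\<phi> s t)" using S by (simp add: S_def falsifies_iff \<pi>)
  from this False obtain c n where c: "c \<in> univ M"
    and chain: "rtc_chain M v ?\<phi> (val M v s) c n"
    and step: "sat M (case_nat c (case_nat (val M v t) v)) ?\<phi>"
    and less: "n < rtc_length M v (FRTC ?\<phi> s t)"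
    by (rule rtc_length_decompose)
  let ?v = "v(z := c)"
  \<comment> \<open>Under the two binders of the body, \<open>z\<close> has index
    \<open>Suc (Suc z)\<close>.\<close>
  have fv: "z \<notin> fv_tm s" "z \<notin> fv_tm t" "Suc (Suc z) \<notin> fv_fm ?\<phi>"
    using z by (auto simp: \<pi>)
  have sat_eq: "sat M (case_nat d (case_nat e ?v)) ?\<phi> \<longleftrightarrow> sat M (case_nat d (case_nat e v)) ?\<phi>"
    for d e by (rule sat_cong) (use fv in \<open>auto split: nat.split\<close>)
  have val_s: "val M ?v s = val M v s" and val_t: "val M ?v t = val M v t"
    by (rule val_cong, use fv in auto)+
  have "rtc_chain M ?v ?\<phi> (val M ?v s) (val M ?v (Var z)) n"
    using chain by (simp add: rtc_chain_def sat_eq val_s)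
  then have sat_\<alpha>: "sat M ?v \<alpha>" and "rtc_length M ?v \<alpha> \<le> n"
    unfolding \<alpha> by (auto simp only: sat_FRTC rtc_length.simps intro: Least_le)
  with less have progress: "rtc_length M ?v \<alpha> < rtc_length M v \<pi>" by (simp add: \<pi>)
  have "sat M (case_nat c (case_nat (val M v t) ?v)) ?\<phi>"
    using step by (simp only: sat_eq)
  then have "sat M ?v (sub2 \<phi> (Var z) x t y)"
    using xy by (simp add: sat_rtc_body sat_sub2 val_t)
  with sat_\<alpha> S z c have "falsifies M ?v S2"
    by (auto simp: S_def S2_def falsifies_iff is_valuation_upd fvs_def sat_upd)
  \<comment> \<open>The other trace pairs are identities on formulas of \<open>S\<close>, where
    \<open>z\<close> is not free.\<close>
  moreover have "rtc_length M ?v \<tau> = rtc_length M v \<tau>" if "is_rtc \<tau>" "\<tau> |\<in>| fst S" for \<tau>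
    by (rule rtc_length_cong) (use that z in \<open>auto simp: S_def fvs_def\<close>)
  ultimately have "descends M (Case \<pi> \<alpha>) v S ?v S2"
    using progress by (auto simp: descends_def trace_pair_def)
  then show ?thesis by blast
qed

text \<open>Rules without premises admit no countermodel. Otherwise truth in the given countermodel
  selects the premise, for (Cut) by the value of the cut formula. \<open>wf_sequent\<close> provides
  the well-formed end terms for (Trans).\<close>

lemma rule_inst_descends:
  assumes "rule_inst \<sigma> l S Ss" "wf_sequent \<sigma> S"
    and M: "is_struct \<sigma> M" and "falsifies M v S"
  shows "\<exists>S'\<in>set Ss. \<exists>v'. descends M l v S v' S'"
  using assms(1,2,4)
proof (cases rule: rule_inst.cases)
  case (AllL t x \<phi> \<Gamma> \<Delta>)
  have "val M v t \<in> univ M"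
    using AllL assms(4) val_in_univ[OF M] by (auto simp: falsifies_iff)
  with AllL assms(4) show ?thesis
    by (auto simp: falsifies_iff sat_all_fm sat_sub1 intro!: exI[of _ v] descends_Other)
next
  case (ExR t x \<phi> \<Gamma> \<Delta>)
  have "val M v t \<in> univ M"
    using ExR assms(4) val_in_univ[OF M] by (auto simp: falsifies_iff)
  with ExR assms(4) show ?thesis
    by (auto simp: falsifies_iff sat_ex_fm sat_sub1 intro!: exI[of _ v] descends_Other)
next
  case (AllR x \<Gamma> \<Delta> \<phi>)
  then obtain d where "d \<in> univ M" "\<not> sat M (v(x := d)) \<phi>"
    using assms(4) by (auto simp: falsifies_iff sat_all_fm)
  with AllR assms(4) have "descends M l v S (v(x := d)) (\<Gamma>, finsert \<phi> \<Delta>)"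
    by (auto simp: falsifies_iff is_valuation_upd sat_upd fvs_def intro!: descends_Other_upd)
  with AllR show ?thesis by auto
next
  case (ExL x \<Gamma> \<Delta> \<phi>)
  then obtain d where "d \<in> univ M" "sat M (v(x := d)) \<phi>"
    using assms(4) by (auto simp: falsifies_iff sat_ex_fm)
  \<comment> \<open>The principal formula is existential, hence on no trace; every other formula on
    the left lies in \<open>\<Gamma>\<close>, where \<open>x\<close> is not free.\<close>
  with ExL assms(4) have "descends M l v S (v(x := d)) (finsert \<phi> \<Gamma>, \<Delta>)"
    by (auto simp: falsifies_iff is_valuation_upd sat_upd fvs_def is_rtc_def ex_fm_def rtc_fm_def
        intro!: descends_Other_upd)
  with ExL show ?thesis by auto
next
  case (Subst \<theta> \<Gamma> \<Delta>)
  with assms(4) have "falsifies M (\<lambda>n. val M v (\<theta> n)) (\<Gamma>, \<Delta>)"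
    using falsifies_Subst[OF M] by blast
  then have "descends M l v S (\<lambda>n. val M v (\<theta> n)) (\<Gamma>, \<Delta>)"
    using Subst by (auto simp: descends_def trace_pair_def rtc_length_subst)
  with Subst show ?thesis by auto
next
  case (Trans x y \<Gamma> \<phi> s t \<Delta> r)
  have "wf_tm \<sigma> s" "wf_tm \<sigma> t"
    using Trans assms(2) by (auto simp: wf_sequent_def rtc_fm_def)
  with Trans assms(4) show ?thesis
    using sat_rtc_Trans[OF M, of v x y s t \<phi> r]
    by (auto simp: falsifies_iff intro!: exI[of _ v] descends_Other)
next
  case (Case x y z \<Gamma> \<Delta> \<phi> s t)
  with assms(4) show ?thesis using descends_Case[of x y z \<Gamma> \<Delta> \<phi> s t M v] by simp
next
  case (Refl x y \<Gamma> \<phi> s \<Delta>)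
  with assms(4) show ?thesis by (auto simp: falsifies_iff rtc_fm_def)
next
  case (Cut \<Gamma> \<Sigma> \<Delta> \<Pi> \<phi>)
  with assms(4) show ?thesis
    by (cases "sat M v \<phi>") (auto simp: falsifies_iff intro!: exI[of _ v] descends_Other)
qed (auto simp: falsifies_iff sat_sub1 intro!: exI[of _ v] descends_Other)

section \<open>The infinite path and the contradiction\<close>

lemma preproof_unfold:
  assumes "preproof \<sigma> D"
  shows "wf_sequent \<sigma> (concl D)" "rule_inst \<sigma> (lab D) (concl D) (map concl (subs D))"
    "\<And>E. E \<in> set (subs D) \<Longrightarrow> preproof \<sigma> E"
  using assms by (auto elim: preproof.cases)

text \<open>Dependent choice on pairs of a subderivation and a valuation falsifying its conclusion;
  the conjunct for \<open>n = 0\<close> in the invariant fixes the start at the root.\<close>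

lemma falsifying_path:
  fixes M :: "('d, 'f, 'p) struct"
  assumes M: "is_struct \<sigma> M" and "preproof \<sigma> D" "falsifies M v (concl D)"
  obtains B w where "infinite_path D B"
    "\<And>i. descends M (lab (B i)) (w i) (concl (B i)) (w (Suc i)) (concl (B (Suc i)))"
proof -
  have "\<exists>f. \<forall>n. (preproof \<sigma> (fst (f n)) \<and> falsifies M (snd (f n)) (concl (fst (f n))) \<and>
        (n = 0 \<longrightarrow> fst (f n) = D)) \<and> fst (f (Suc n)) \<in> set (subs (fst (f n))) \<and>
      descends M (lab (fst (f n))) (snd (f n)) (concl (fst (f n)))
        (snd (f (Suc n))) (concl (fst (f (Suc n))))"
  proof (rule dependent_nat_choice)
    show "\<exists>x. preproof \<sigma> (fst x) \<and> falsifies M (snd x) (concl (fst x)) \<and> (0 = 0 \<longrightarrow> fst x = D)"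
      using assms by auto
  next
    fix x :: "('f, 'p) deriv \<times> (nat \<Rightarrow> 'd)" and n :: nat
    assume "preproof \<sigma> (fst x) \<and> falsifies M (snd x) (concl (fst x)) \<and> (n = 0 \<longrightarrow> fst x = D)"
    then have x: "preproof \<sigma> (fst x)" "falsifies M (snd x) (concl (fst x))" by auto
    note D = preproof_unfold[OF x(1)]
    from rule_inst_descends[OF D(2,1) M x(2)] obtain E w where
      "E \<in> set (subs (fst x))"
      "descends M (lab (fst x)) (snd x) (concl (fst x)) w (concl E)" by auto
    moreover from this have "falsifies M w (concl E)" by (simp add: descends_def)
    ultimately show "\<exists>y. (preproof \<sigma> (fst y) \<and> falsifies M (snd y) (concl (fst y)) \<and>
        (Suc n = 0 \<longrightarrow> fst y = D)) \<and> fst y \<in> set (subs (fst x)) \<and>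
      descends M (lab (fst x)) (snd x) (concl (fst x)) (snd y) (concl (fst y))"
      using D(3) by (intro exI[of _ "(E, w)"]) auto
  qed
  then obtain f where "fst (f 0) = D" "\<And>n. fst (f (Suc n)) \<in> set (subs (fst (f n)))"
    "\<And>n. descends M (lab (fst (f n))) (snd (f n)) (concl (fst (f n)))
        (snd (f (Suc n))) (concl (fst (f (Suc n))))"
    by blast
  then show thesis
    by (intro that[of "\<lambda>n. fst (f n)" "\<lambda>n. snd (f n)"]) (auto simp: infinite_path_def)
qed

text \<open>From an index where \<open>g\<close> attains its minimum on, the antitone
  \<open>g\<close> is constant, so no strict decrease can follow.\<close>

lemma no_infinite_decrease:
  fixes g :: "nat \<Rightarrow> nat"
  assumes "\<And>i. g (Suc i) \<le> g i" "\<exists>\<^sub>\<infinity>i. g (Suc i) < g i"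
  shows False
proof -
  have "g n = g m" if "n \<ge> m" and min: "\<And>i. g m \<le> g i" for n m
    using lift_Suc_antimono_le[of g, OF assms(1) \<open>n \<ge> m\<close>] min[of n] by simp
  moreover obtain m where "\<And>i. g m \<le> g i"
    using ex_has_least_nat[of "\<lambda>_. True" _ g] by auto
  moreover obtain i where "i \<ge> m" "g (Suc i) < g i"
    using assms(2) by (auto simp: INFM_nat_le)
  ultimately show False by (metis le_SucI less_irrefl)
qed

theorem theorem2:
  fixes \<sigma> :: "('f, 'p) signature" and \<Gamma> \<Delta> :: "('f, 'p) fm fset"
  assumes "wf_sequent \<sigma> (\<Gamma>, \<Delta>)"
    and "\<exists>D. is_proof \<sigma> D \<and> concl D = (\<Gamma>, \<Delta>)"
  shows "valid TYPE('d) \<sigma> (\<Gamma>, \<Delta>)"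
proof (rule ccontr)
  assume "\<not> valid TYPE('d) \<sigma> (\<Gamma>, \<Delta>)"
  then obtain M :: "('d, 'f, 'p) struct" and v where M: "is_struct \<sigma> M" "falsifies M v (\<Gamma>, \<Delta>)"
    by (auto simp: not_valid_falsifies)
  from assms(2) obtain D where D: "preproof \<sigma> D" "concl D = (\<Gamma>, \<Delta>)"
    and progress: "\<And>B. infinite_path D B \<Longrightarrow> \<exists>k \<tau>. trace_follows k \<tau> B \<and>
           (\<exists>\<^sub>\<infinity>i. progressing (lab (B (i + k))) (\<tau> i) (\<tau> (i + 1)))"
    by (auto simp: is_proof_def)
  obtain B w where B: "infinite_path D B"
    and desc: "\<And>i. descends M (lab (B i)) (w i) (concl (B i)) (w (Suc i)) (concl (B (Suc i)))"
    using falsifying_path[OF M(1) D(1), of v] M(2) D(2) by metis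
  obtain k \<tau> where trace: "trace_follows k \<tau> B"
    and inf: "\<exists>\<^sub>\<infinity>i. progressing (lab (B (i + k))) (\<tau> i) (\<tau> (i + 1))"
    using progress[OF B] by blast
  \<comment> \<open>The trace starts at node \<open>k\<close> of the path, so its formula
    \<open>\<tau> i\<close> is measured under the valuation at node \<open>i + k\<close>.\<close>
  define g where "g i = rtc_length M (w (i + k)) (\<tau> i)" for i
  have le: "g (Suc i) \<le> g i" and
    less: "progressing (lab (B (i + k))) (\<tau> i) (\<tau> (i + 1)) \<Longrightarrow> g (Suc i) < g i" for i
    using desc[of "i + k"] trace by (auto simp: g_def descends_def trace_follows_def)
  from inf have "\<exists>\<^sub>\<infinity>i. g (Suc i) < g i"
    by (rule INFM_mono) (rule less)
  with le show False by (rule no_infinite_decrease)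
qed

end
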